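(* Let $\varrho(n)$ denote the number of integers $a$ with $1\le a\le n$ for which there exists an integer $x$ with $a^2x\equiv a\pmod n$, and let $\phi$ be Euler's totient function. Then, for real $x\ge 2$, \[ \sum_{n\le x}\frac{\varrho(n)}{\phi(n)} = Bx+O(\log^2 x),\qquad B=\frac{\pi^2}{6}. \]
   Context: An integer $a$ is called regular (mod $n$) if there is an integer $x$ with $a^2x\equiv a \pmod n$; $\varrho(n)$ counts regular integers (mod $n$) in $\{1,\dots,n\}$ (so $\varrho(1)=1$). Equivalently, $\varrho$ is multiplicative with $\varrho(p^\nu)=p^\nu-p^{\nu-1}+1$ for prime powers. *)

theory Defs
  imports Complex_Main "HOL-Number_Theory.Cong" "HOL-Number_Theory.Totient"
begin

definition regular_mod :: "nat \<Rightarrow> int \<Rightarrow> bool" where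
  "regular_mod n a \<longleftrightarrow> (\<exists>x::int. [a\<^sup>2 * x = a] (mod int n))"

definition varrho :: "nat \<Rightarrow> nat" where
  "varrho n = card {a \<in> {1..int n}. regular_mod n a}"

end

theory Submission
  imports Defs "HOL-Analysis.Gamma_Function"
begin

text \<open>
  An integer \<open>a\<close> is regular mod \<open>n\<close> iff \<open>gcd a n\<close> is a unitary divisor of \<open>n\<close>, so
  \<open>varrho n / totient n\<close> is the sum of \<open>1 / totient e\<close> over the unitary divisors \<open>e\<close> of \<open>n\<close>.
  Summing over \<open>n \<le> N\<close>, each \<open>e\<close> is counted once for every \<open>m \<le> N / e\<close> coprime to \<open>e\<close>,
  that is \<open>N * totient e / e\<^sup>2 + O(2 ^ \<omega> e)\<close> times. The main terms give \<open>N\<close> times a partial sum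
  of \<open>\<Sum> 1 / e\<^sup>2 = pi\<^sup>2 / 6\<close>. The errors \<open>2 ^ \<omega> e / totient e\<close> sum to \<open>O(ln\<^sup>2 N)\<close> because
  \<open>2 ^ \<omega> e\<close> is at most the number of divisors of \<open>e\<close>, and \<open>e / totient e \<le> 2 * (\<Sum>d | d dvd e. 1 / d)\<close>;
  after writing \<open>e = d * m\<close> the sum over \<open>d\<close> converges and the sum over \<open>m\<close> is at most
  the square of a harmonic sum.
\<close>

section \<open>Regular integers and unitary divisors\<close>

text \<open>Write a = g a' and n = g n' with a', n' coprime. Cancelling g and then a' turns the
  congruence into a x = 1 mod n', which is solvable iff a is coprime to n'; as a' already is, only g
  matters.\<close>

lemma regular_mod_iff_coprime_gcd:
  fixes n a :: nat
  assumes "n > 0"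
  shows "regular_mod n (int a) \<longleftrightarrow> coprime (gcd a n) (n div gcd a n)"
proof -
  define g where "g = gcd a n"
  obtain a' n' where a': "a = g * a'" and n': "n = g * n'" and cop: "coprime a' n'"
    using gcd_coprime_exists[of a n] assms unfolding g_def by (metis gcd_eq_0_iff mult.commute not_gr_zero)
  have g: "g > 0"
    using n' assms by (auto intro!: Nat.gr0I)
  have "regular_mod n (int a) \<longleftrightarrow> (\<exists>x::int. int n dvd (int a)\<^sup>2 * x - int a)"
    by (simp add: regular_mod_def cong_iff_dvd_diff)
  also have "\<dots> \<longleftrightarrow> (\<exists>x::int. int n' dvd int a * x - 1)"
  proof (intro ex_cong1)
    fix x :: int
    have "(int a)\<^sup>2 * x - int a = int g * (int a' * (int a * x - 1))"
      by (simp add: a' power2_eq_square algebra_simps)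
    then have "int n dvd (int a)\<^sup>2 * x - int a \<longleftrightarrow> int n' dvd int a' * (int a * x - 1)"
      using g by (simp add: n')
    also have "\<dots> \<longleftrightarrow> int n' dvd int a * x - 1"
      using cop by (intro coprime_dvd_mult_right_iff) (simp add: coprime_commute)
    finally show "int n dvd (int a)\<^sup>2 * x - int a \<longleftrightarrow> int n' dvd int a * x - 1" .
  qed
  also have "\<dots> \<longleftrightarrow> coprime (int a) (int n')"
    by (simp add: coprime_iff_invertible_int cong_iff_dvd_diff)
  also have "\<dots> \<longleftrightarrow> coprime g n'"
    using cop by (auto simp: a')
  finally show ?thesis
    using n' g unfolding g_def[symmetric] by (metis nonzero_mult_div_cancel_left not_gr0)
qed

text \<open>Group the regular integers by their gcd d with n; the class of d has
  \<open>totient (n div d)\<close> elements.\<close>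

lemma varrho_eq_sum_unitary_divisors:
  assumes "n > 0"
  shows "varrho n = (\<Sum>d | d dvd n \<and> coprime d (n div d). totient (n div d))"
proof -
  define A where "A d = {k\<in>{0<..n}. gcd k n = d}" for d
  let ?D = "{d. d dvd n \<and> coprime d (n div d)}"
  have "{a \<in> {1..int n}. regular_mod n a} = int ` (\<Union>d\<in>?D. A d)"
  proof (intro equalityI subsetI)
    fix a assume a: "a \<in> {a \<in> {1..int n}. regular_mod n a}"
    then obtain k where k: "a = int k" "0 < k" "k \<le> n"
      by (metis (no_types, lifting) atLeastAtMost_iff mem_Collect_eq of_nat_0_less_iff of_nat_le_iff
        order_less_le_trans zero_less_one zero_less_imp_eq_int)
    then have "gcd k n \<in> ?D" "k \<in> A (gcd k n)"
      using a regular_mod_iff_coprime_gcd[OF assms, of k] by (auto simp: A_def)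
    then show "a \<in> int ` (\<Union>d\<in>?D. A d)"
      using k by blast
  next
    fix a assume "a \<in> int ` (\<Union>d\<in>?D. A d)"
    then obtain k where "a = int k" "coprime (gcd k n) (n div gcd k n)" "0 < k" "k \<le> n"
      by (auto simp: A_def)
    then show "a \<in> {a \<in> {1..int n}. regular_mod n a}"
      using regular_mod_iff_coprime_gcd[OF assms] by auto
  qed
  then have "varrho n = card (\<Union>d\<in>?D. A d)"
    by (simp add: varrho_def card_image)
  also have "\<dots> = (\<Sum>d\<in>?D. card (A d))"
    using assms by (intro card_UN_disjoint) (auto simp: A_def)
  also have "\<dots> = (\<Sum>d\<in>?D. totient (n div d))"
    unfolding A_def using assms by (intro sum.cong card_gcd_eq_totient refl) auto
  finally show ?thesis .
qed

text \<open>The totient is multiplicative across a unitary divisor. The coprimality condition moves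
  into an \<open>if\<close> so that the sum has the shape needed by
  \<open>sum_divisors_swap\<close>.\<close>

lemma varrho_div_totient:
  assumes "n > 0"
  shows "real (varrho n) / real (totient n) =
    (\<Sum>d | d dvd n. if coprime d (n div d) then 1 / real (totient d) else 0)"
proof -
  have "real (varrho n) / real (totient n) =
      (\<Sum>d | d dvd n \<and> coprime d (n div d). real (totient (n div d)) / real (totient n))"
    using assms by (simp add: varrho_eq_sum_unitary_divisors sum_divide_distrib)
  also have "\<dots> = (\<Sum>d | d dvd n \<and> coprime d (n div d). 1 / real (totient d))"
  proof (intro sum.cong refl)
    fix d assume d: "d \<in> {d. d dvd n \<and> coprime d (n div d)}"
    then have "totient n = totient d * totient (n div d)"
      by (metis (mono_tags, lifting) dvd_mult_div_cancel mem_Collect_eq totient_mult_coprime)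
    moreover have "totient n > 0" using assms by simp
    ultimately show "real (totient (n div d)) / real (totient n) = 1 / real (totient d)"
      by (auto simp: field_simps)
  qed
  also have "\<dots> = (\<Sum>d | d dvd n. if coprime d (n div d) then 1 / real (totient d) else 0)"
    using assms by (subst sum.If_cases) (auto intro!: sum.cong)
  finally show ?thesis .
qed

section \<open>Rearranging divisor sums\<close>

lemma sum_divisors_swap:
  fixes F :: "nat \<Rightarrow> nat \<Rightarrow> real"
  shows "(\<Sum>n=1..N. \<Sum>d | d dvd n. F d (n div d)) = (\<Sum>d=1..N. \<Sum>m=1..N div d. F d m)"
proof -
  have "(\<Sum>n=1..N. \<Sum>d | d dvd n. F d (n div d)) =
      (\<Sum>(n, d)\<in>(SIGMA n:{1..N}. {d. d dvd n}). F d (n div d))"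
    by (subst sum.Sigma) auto
  also have "\<dots> = (\<Sum>(d, m)\<in>(SIGMA d:{1..N}. {1..N div d}). F d m)"
  proof (rule sum.reindex_bij_witness[of _ "\<lambda>(d, m). (d * m, d)" "\<lambda>(n, d). (d, n div d)"], goal_cases)
    case (2 x)
    then obtain d m where x: "x = (d * m, d)" "0 < d" "0 < m" "d * m \<le> N"
      by (auto elim!: dvdE)
    moreover have "d \<le> N"
      using x by (metis Suc_le_eq One_nat_def le_trans mult.right_neutral mult_le_mono2)
    ultimately show ?case
      by (auto simp: less_eq_div_iff_mult_less_eq mult.commute)
  next
    case (4 x)
    then show ?case
      by (auto simp: Suc_le_eq less_eq_div_iff_mult_less_eq mult.commute)
  qed auto
  also have "\<dots> = (\<Sum>d=1..N. \<Sum>m=1..N div d. F d m)"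
    by (subst sum.Sigma) auto
  finally show ?thesis .
qed

text \<open>Dropping the condition d m \<le> N leaves a full square of indices, over which a product
  \<open>F\<close> splits into two independent sums.\<close>

lemma sum_divisors_le:
  fixes F :: "nat \<Rightarrow> nat \<Rightarrow> real"
  assumes "\<And>d m. F d m \<ge> 0"
  shows "(\<Sum>n=1..N. \<Sum>d | d dvd n. F d (n div d)) \<le> (\<Sum>d=1..N. \<Sum>m=1..N. F d m)"
  unfolding sum_divisors_swap
proof (intro sum_mono sum_mono2)
  fix d :: nat
  show "{1..N div d} \<subseteq> {1..N}"
    using div_le_dividend[of N d] by auto
qed (use assms in auto)

section \<open>Counting integers coprime to e\<close>

lemma coprime_iff_prime_factors:
  fixes d e :: nat
  assumes "e > 0"
  shows "coprime d e \<longleftrightarrow> (\<forall>p\<in>prime_factors e. \<not> p dvd d)"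
proof
  assume "coprime d e"
  then show "\<forall>p\<in>prime_factors e. \<not> p dvd d"
    by (metis coprime_common_divisor in_prime_factors_iff not_prime_unit)
next
  assume *: "\<forall>p\<in>prime_factors e. \<not> p dvd d"
  show "coprime d e"
  proof (rule ccontr)
    assume "\<not> coprime d e"
    then obtain p where "prime p" "p dvd gcd d e"
      by (metis coprime_iff_gcd_eq_1 prime_factor_nat)
    then show False
      using * assms by (auto simp: in_prime_factors_iff)
  qed
qed

text \<open>Inclusion-exclusion, one prime at a time: the integers up to t avoiding \<open>P\<close>
  are those that also avoid q, together with q times those up to t / q avoiding \<open>P\<close>.
  Each new prime at most doubles the error bound. The induction hypothesis is needed at t / q as
  well, hence real, arbitrary t.\<close>

lemma card_no_prime_divisor_approx:
  fixes P :: "nat set" and t :: real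
  assumes "finite P" "\<And>p. p \<in> P \<Longrightarrow> prime p" "t \<ge> 0"
  shows "\<bar>real (card {d. 0 < d \<and> real d \<le> t \<and> (\<forall>p\<in>P. \<not> p dvd d)}) - t * (\<Prod>p\<in>P. 1 - 1 / real p)\<bar>
    \<le> 2 ^ card P"
  using assms
proof (induction P arbitrary: t rule: finite_induct)
  case empty
  have "{d. 0 < d \<and> real d \<le> t} = {1..nat \<lfloor>t\<rfloor>}"
    using empty by (auto simp: le_nat_floor) (metis le_floor_iff nat_le_iff of_int_of_nat_eq le_nat_iff zero_le_floor)
  then show ?case
    using empty by (simp add: of_nat_nat) linarith
next
  case (insert q P)
  define A where "A P t = {d. 0 < d \<and> real d \<le> t \<and> (\<forall>p\<in>P. \<not> p dvd d)}" for P and t :: real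
  define R where "R = (\<Prod>p\<in>P. 1 - 1 / real p)"
  have fin: "finite (A P t)" for P t
  proof (rule finite_subset)
    show "A P t \<subseteq> {..nat \<lfloor>t\<rfloor>}"
      by (auto simp: A_def le_nat_floor)
  qed auto
  have q: "prime q" "q > 0"
    using insert.prems by (auto intro: prime_gt_0_nat)
  \<comment> \<open>Multiplication by q must not introduce a divisor from \<open>P\<close>.\<close>
  have not_dvd: "\<not> p dvd q" if "p \<in> P" for p
    using that insert.prems insert.hyps primes_dvd_imp_eq by blast
  have "A P t = A (insert q P) t \<union> (*) q ` A P (t / q)"
  proof (intro equalityI subsetI)
    fix d assume d: "d \<in> A P t"
    show "d \<in> A (insert q P) t \<union> (*) q ` A P (t / q)"
    proof (cases "q dvd d")
      case True
      then obtain k where "d = q * k" ..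
      moreover have "k \<in> A P (t / q)"
        using d q \<open>d = q * k\<close> by (auto simp: A_def field_simps)
      ultimately show ?thesis
        by blast
    qed (use d in \<open>auto simp: A_def\<close>)
  next
    fix d assume "d \<in> A (insert q P) t \<union> (*) q ` A P (t / q)"
    then show "d \<in> A P t"
      using q not_dvd insert.prems by (auto simp: A_def field_simps prime_dvd_mult_iff)
  qed
  moreover have "A (insert q P) t \<inter> (*) q ` A P (t / q) = {}"
    by (auto simp: A_def)
  ultimately have "card (A P t) = card (A (insert q P) t) + card ((*) q ` A P (t / q))"
    using fin by (simp add: card_Un_disjoint)
  also have "card ((*) q ` A P (t / q)) = card (A P (t / q))"
    using q by (intro card_image inj_onI) auto
  finally have card: "real (card (A (insert q P) t)) = real (card (A P t)) - real (card (A P (t / q)))"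
    by simp
  have "\<bar>real (card (A P t)) - t * R\<bar> \<le> 2 ^ card P"
    using insert.IH[of t] insert.prems by (simp add: A_def R_def)
  moreover have "\<bar>real (card (A P (t / q))) - t / q * R\<bar> \<le> 2 ^ card P"
    using insert.IH[of "t / q"] insert.prems by (simp add: A_def R_def)
  moreover have "t * (\<Prod>p\<in>insert q P. 1 - 1 / real p) = t * R - t / q * R"
    using insert.hyps by (simp add: R_def algebra_simps)
  ultimately have "\<bar>real (card (A (insert q P) t)) - t * (\<Prod>p\<in>insert q P. 1 - 1 / real p)\<bar> \<le> 2 ^ card P + 2 ^ card P"
    unfolding card by (smt (verit))
  then show ?case
    using insert.hyps by (simp add: A_def)
qed

text \<open>The sieve at t = N / e, with Euler's product for \<open>totient e / e\<close>.\<close>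

lemma card_coprime_approx:
  fixes N e :: nat
  assumes "e > 0"
  shows "\<bar>real (card {d\<in>{1..N div e}. coprime d e}) - real N * real (totient e) / (real e)\<^sup>2\<bar>
    \<le> 2 ^ card (prime_factors e)"
proof -
  have *: "{d\<in>{1..N div e}. coprime d e} =
      {d. 0 < d \<and> real d \<le> real N / real e \<and> (\<forall>p\<in>prime_factors e. \<not> p dvd d)}"
  proof -
    have "d \<le> N div e \<longleftrightarrow> real d \<le> real N / real e" for d
      using assms by (simp add: less_eq_div_iff_mult_less_eq field_simps flip: of_nat_mult)
    then show ?thesis
      using coprime_iff_prime_factors[OF assms] by (auto simp: Suc_le_eq)
  qed
  have "real N * real (totient e) / (real e)\<^sup>2 =
      real N / real e * (\<Prod>p\<in>prime_factors e. 1 - 1 / real p)"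
    using assms by (simp add: totient_formula2 power2_eq_square)
  then show ?thesis
    unfolding * using card_no_prime_divisor_approx[of "prime_factors e" "real N / real e"]
    by (auto simp: in_prime_factors_iff)
qed

section \<open>Bounds for the totient and the number of prime factors\<close>

text \<open>Expanding the product gives one term for each set of prime factors, that is, for each
  squarefree divisor. The case s = 1 bounds n / \<open>totient n\<close>; the case s = 0 compares 2
  ^ \<omega> n with the divisor count.\<close>

lemma prod_prime_factors_le_sum_divisors:
  fixes n s :: nat
  assumes "n > 0"
  shows "(\<Prod>p\<in>prime_factors n. 1 + 1 / real p ^ s) \<le> (\<Sum>d | d dvd n. 1 / real d ^ s)"
proof -
  let ?P = "prime_factors n"
  \<comment> \<open>The set is recovered from its product, so distinct sets give distinct
    divisors.\<close>
  have pf: "prime_factors (\<Prod>S) = S" if "S \<subseteq> ?P" for S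
  proof -
    have fin: "finite S" using that finite_subset by blast
    have primes: "prime p" if "p \<in> S" for p
      using that \<open>S \<subseteq> ?P\<close> by (auto simp: in_prime_factors_iff)
    then have "\<Prod>S \<noteq> 0"
      using fin by (metis not_prime_0 prod_zero_iff)
    moreover have "p dvd \<Prod>S \<longleftrightarrow> p \<in> S" if "prime p" for p
      using that fin primes primes_dvd_imp_eq[of p] by (simp add: prime_dvd_prod_iff) (metis dvd_refl)
    ultimately show ?thesis
      using primes by (auto simp: in_prime_factors_iff)
  qed
  have inj: "inj_on (\<lambda>S. \<Prod>S) (Pow ?P)"
    by (rule inj_on_inverseI[of _ prime_factors]) (use pf in auto)
  have dvd: "\<Prod>S dvd n" if "S \<subseteq> ?P" for S
  proof -
    have "\<Prod>S dvd \<Prod>?P"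
      using that by (intro prod_dvd_prod_subset) auto
    also have "\<dots> dvd (\<Prod>p\<in>?P. p ^ multiplicity p n)"
      by (intro prod_dvd_prod) (auto simp: in_prime_factors_iff dvd_power prime_factors_multiplicity)
    also have "\<dots> = n"
      using assms by (simp add: prod_prime_factors)
    finally show ?thesis .
  qed
  have "(\<Prod>p\<in>?P. 1 + 1 / real p ^ s) = (\<Prod>p\<in>?P. 1 / real p ^ s + 1)"
    by (simp add: add.commute)
  also have "\<dots> = (\<Sum>S\<in>Pow ?P. 1 / real (\<Prod>S) ^ s)"
    by (subst prod_add) (auto simp: prod_dividef prod_power_distrib)
  also have "\<dots> = (\<Sum>d\<in>(\<lambda>S. \<Prod>S) ` Pow ?P. 1 / real d ^ s)"
    by (subst sum.reindex[OF inj]) simp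
  also have "\<dots> \<le> (\<Sum>d | d dvd n. 1 / real d ^ s)"
    using dvd assms by (intro sum_mono2) auto
  finally show ?thesis .
qed

text \<open>Enlarging \<open>P\<close> to all integers from 2 to n only inserts factors in [0, 1],
  and the full product telescopes to (n + 1) / (2 n).\<close>

lemma prod_one_minus_inverse_square_ge:
  fixes P :: "nat set"
  assumes "finite P" "\<And>p. p \<in> P \<Longrightarrow> p \<ge> 2"
  shows "(\<Prod>p\<in>P. 1 - 1 / (real p)\<^sup>2) \<ge> 1 / 2"
proof -
  have telescope: "(\<Prod>k=2..n. 1 - 1 / (real k)\<^sup>2) = (real n + 1) / (2 * real n)" if "n \<ge> 1" for n
    using that
  proof (induction n rule: dec_induct)
    case (step n)
    have "(\<Prod>k=2..Suc n. 1 - 1 / (real k)\<^sup>2) = (real n + 1) / (2 * real n) * (1 - 1 / (real (Suc n))\<^sup>2)"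
      using step by (subst prod.cl_ivl_Suc) simp
    also have "\<dots> = (real (Suc n) + 1) / (2 * real (Suc n))"
      using step.hyps by (simp add: divide_simps power2_eq_square) (simp add: algebra_simps)
    finally show ?case .
  qed simp
  obtain n where n: "P \<subseteq> {2..n}" "n \<ge> 1"
  proof
    \<comment> \<open>\<open>Suc\<close> secures n \<ge> 1 even for empty \<open>P\<close>, where
      \<open>Max P\<close> is unspecified.\<close>
    show "P \<subseteq> {2..Suc (Max P)}"
      using assms Max_ge[OF assms(1)] by (auto intro!: le_SucI)
  qed auto
  have "1 / 2 \<le> (real n + 1) / (2 * real n)"
    using n by (simp add: field_simps)
  also have "\<dots> = (\<Prod>k\<in>{2..n} - P. 1 - 1 / (real k)\<^sup>2) * (\<Prod>k\<in>P. 1 - 1 / (real k)\<^sup>2)"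
    using n prod.subset_diff[OF n(1), of "\<lambda>k. 1 - 1 / (real k)\<^sup>2"] telescope[of n] by simp
  also have "\<dots> \<le> 1 * (\<Prod>k\<in>P. 1 - 1 / (real k)\<^sup>2)"
    using n by (intro mult_right_mono prod_le_1 prod_nonneg) (auto simp: field_simps)
  finally show ?thesis by simp
qed

text \<open>Here \<open>totient n\<close> = n R, and R T is a product of factors 1 - 1 / p^2, hence
  at least 1 / 2. So 1 / R \<le> 2 T, and T is bounded by the divisor sum.\<close>

lemma inverse_totient_le:
  assumes "n > 0"
  shows "1 / real (totient n) \<le> 2 / real n * (\<Sum>d | d dvd n. 1 / real d)"
proof -
  let ?P = "prime_factors n"
  have ge2: "p \<ge> 2" if "p \<in> ?P" for p
    using that by (auto simp: in_prime_factors_iff prime_ge_2_nat)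
  define R where "R = (\<Prod>p\<in>?P. 1 - 1 / real p)"
  define T where "T = (\<Prod>p\<in>?P. 1 + 1 / real p)"
  have R: "R > 0"
    unfolding R_def using ge2 by (intro prod_pos) (fastforce simp: field_simps)
  have "R * T = (\<Prod>p\<in>?P. 1 - 1 / (real p)\<^sup>2)"
    unfolding R_def T_def by (simp flip: prod.distrib) (simp add: algebra_simps power2_eq_square)
  then have "R * T \<ge> 1 / 2"
    using prod_one_minus_inverse_square_ge[of ?P] ge2 by simp
  then have "1 / R \<le> 2 * T"
    using R by (simp add: field_simps)
  also have "T \<le> (\<Sum>d | d dvd n. 1 / real d)"
    using prod_prime_factors_le_sum_divisors[OF assms, of 1] by (simp add: T_def)
  finally have "1 / R \<le> 2 * (\<Sum>d | d dvd n. 1 / real d)" by simp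
  then have "1 / real n * (1 / R) \<le> 1 / real n * (2 * (\<Sum>d | d dvd n. 1 / real d))"
    by (intro mult_left_mono) auto
  then show ?thesis
    by (simp add: totient_formula2 R_def)
qed

lemma two_power_card_prime_factors_le:
  fixes n :: nat
  assumes "n > 0"
  shows "2 ^ card (prime_factors n) \<le> card {d. d dvd n}"
proof -
  have "real (2 ^ card (prime_factors n)) \<le> real (card {d. d dvd n})"
    using prod_prime_factors_le_sum_divisors[OF assms, of 0] by simp
  then show ?thesis
    by (simp only: of_nat_le_iff)
qed

lemma card_divisors_mult_le:
  fixes a b :: nat
  assumes "a > 0" "b > 0"
  shows "card {d. d dvd a * b} \<le> card {d. d dvd a} * card {d. d dvd b}"
proof -
  have "{d. d dvd a * b} \<subseteq> (\<lambda>(x, y). x * y) ` ({d. d dvd a} \<times> {d. d dvd b})"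
    using division_decomp by force
  then have "card {d. d dvd a * b} \<le> card ({d. d dvd a} \<times> {d. d dvd b})"
    using assms by (intro surj_card_le) auto
  then show ?thesis
    by (simp add: card_cartesian_product)
qed

section \<open>Partial sums of 1 / n^2, 1 / n and the divisor function\<close>

lemma sum_inverse_square_approx:
  fixes N :: nat
  assumes "N \<ge> 1"
  shows "(\<Sum>n=1..N. 1 / (real n)\<^sup>2) \<le> pi\<^sup>2 / 6" (is ?le)
    and "pi\<^sup>2 / 6 \<le> (\<Sum>n=1..N. 1 / (real n)\<^sup>2) + 1 / real N" (is ?ge)
proof -
  define u where "u n = (\<Sum>k<n. 1 / (real (k + 1))\<^sup>2)" for n
  have sums: "(\<lambda>k. 1 / (real (k + 1))\<^sup>2) sums (pi\<^sup>2 / 6)"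
    using inverse_squares_sums by (simp add: add.commute)
  have u: "(\<Sum>n=1..N. 1 / (real n)\<^sup>2) = u N" for N
    unfolding u_def by (rule sum.reindex_bij_witness[of _ Suc "\<lambda>n. n - 1"]) auto
  have lim: "u \<longlonglongrightarrow> pi\<^sup>2 / 6"
    using sums by (simp add: sums_def u_def[abs_def])
  have "incseq u"
    by (intro incseq_SucI) (simp add: u_def)
  then show ?le
    unfolding u using incseq_le[OF _ lim] by blast
  \<comment> \<open>The term - 1 / n makes the induction telescope, through 1 / (n + 1)^2 \<le> 1 /
    n - 1 / (n + 1).\<close>
  have "u n \<le> u N + 1 / real N - 1 / real n" if "n \<ge> N" for n
    using that
  proof (induction n rule: dec_induct)
    case (step n)
    have "1 / (real (n + 1))\<^sup>2 \<le> 1 / real n - 1 / real (Suc n)"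
      using step.hyps assms by (simp add: divide_simps power2_eq_square)
    then show ?case
      using step.IH by (simp add: u_def)
  qed simp
  then have "\<forall>n\<ge>N. u n \<le> u N + 1 / real N"
    by (smt (verit) divide_nonneg_nonneg of_nat_0_le_iff)
  then show ?ge
    unfolding u using LIMSEQ_le_const2[OF lim] by blast
qed

text \<open>The difference of the harmonic number and the logarithm decreases from its value 1 at n
  = 1.\<close>

lemma sum_inverse_le_ln: "n \<ge> 1 \<Longrightarrow> (\<Sum>k=1..n. 1 / real k) \<le> 1 + ln (real n)"
proof -
  assume "n \<ge> 1"
  then obtain m where m: "n = Suc m" by (cases n) auto
  have "harm (Suc m) - ln (real (Suc m)) \<le> harm (Suc 0) - ln (real (Suc 0))"
    using decseqD[OF decseq_harm_diff_ln, of 0 m] by simp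
  then show ?thesis
    by (simp add: m harm_def inverse_eq_divide)
qed

text \<open>The summand is the Dirichlet convolution of 1 / n^s with itself, so
  \<open>sum_divisors_le\<close> bounds the sum by a square.\<close>

lemma sum_card_divisors_div_power_le:
  "(\<Sum>n=1..N. real (card {d. d dvd n}) / real n ^ s) \<le> (\<Sum>n=1..N. 1 / real n ^ s)\<^sup>2"
proof -
  have "(\<Sum>n=1..N. real (card {d. d dvd n}) / real n ^ s) =
      (\<Sum>n=1..N. \<Sum>d | d dvd n. 1 / real d ^ s * (1 / real (n div d) ^ s))"
  proof (intro sum.cong refl)
    fix n assume "n \<in> {1..N}"
    have "(\<Sum>d | d dvd n. 1 / real d ^ s * (1 / real (n div d) ^ s)) = (\<Sum>d | d dvd n. 1 / real n ^ s)"
      by (intro sum.cong refl) (auto simp flip: power_mult_distrib of_nat_mult)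
    then show "real (card {d. d dvd n}) / real n ^ s =
        (\<Sum>d | d dvd n. 1 / real d ^ s * (1 / real (n div d) ^ s))"
      by simp
  qed
  also have "\<dots> \<le> (\<Sum>d=1..N. \<Sum>m=1..N. 1 / real d ^ s * (1 / real m ^ s))"
    by (intro sum_divisors_le) auto
  also have "\<dots> = (\<Sum>n=1..N. 1 / real n ^ s)\<^sup>2"
    by (simp only: power2_eq_square sum_product)
  finally show ?thesis .
qed

section \<open>The total error of the coprime counts\<close>

lemma sum_two_power_div_totient_le:
  assumes "N \<ge> 1"
  shows "(\<Sum>n=1..N. 2 ^ card (prime_factors n) / real (totient n)) \<le> 8 * (1 + ln (real N))\<^sup>2"
proof -
  define \<tau> where "\<tau> n = real (card {d. d dvd n})" for n :: nat
  have \<tau>_nonneg: "\<tau> n \<ge> 0" for n by (simp add: \<tau>_def)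
  \<comment> \<open>For n = d m, submultiplicativity gives \<tau> n / (n d) \<le>
    \<open>F d m\<close>. The exponent 1 is kept so that both factors match
    \<open>sum_card_divisors_div_power_le\<close>.\<close>
  define F where "F d m = \<tau> d / real d ^ 2 * (\<tau> m / real m ^ 1)" for d m
  have "(\<Sum>n=1..N. 2 ^ card (prime_factors n) / real (totient n)) \<le>
      (\<Sum>n=1..N. 2 * (\<Sum>d | d dvd n. F d (n div d)))"
  proof (intro sum_mono)
    fix n assume "n \<in> {1..N}"
    then have n: "n > 0" by simp
    have "2 ^ card (prime_factors n) \<le> \<tau> n"
      using two_power_card_prime_factors_le[OF n] unfolding \<tau>_def by (metis of_nat_le_iff of_nat_numeral of_nat_power)
    then have "2 ^ card (prime_factors n) * (1 / real (totient n)) \<le>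
        \<tau> n * (2 / real n * (\<Sum>d | d dvd n. 1 / real d))"
      using inverse_totient_le[OF n] by (intro mult_mono) (auto simp: \<tau>_nonneg)
    also have "\<dots> = 2 * (\<Sum>d | d dvd n. \<tau> n / (real n * real d))"
      by (simp add: sum_distrib_left mult_ac)
    also have "\<dots> \<le> 2 * (\<Sum>d | d dvd n. F d (n div d))"
    proof (intro mult_left_mono sum_mono)
      fix d assume "d \<in> {d. d dvd n}"
      then obtain m where m: "n = d * m" by auto
      then have pos: "d > 0" "m > 0" using n by auto
      have "\<tau> n \<le> \<tau> d * \<tau> m"
        using card_divisors_mult_le[OF pos] unfolding \<tau>_def m by (metis of_nat_le_iff of_nat_mult)
      then have "\<tau> n / (real n * real d) \<le> \<tau> d * \<tau> m / (real n * real d)"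
        by (intro divide_right_mono) auto
      also have "\<dots> = F d (n div d)"
        using pos by (simp add: F_def m power2_eq_square)
      finally show "\<tau> n / (real n * real d) \<le> F d (n div d)" .
    qed auto
    finally show "2 ^ card (prime_factors n) / real (totient n) \<le> 2 * (\<Sum>d | d dvd n. F d (n div d))"
      by simp
  qed
  also have "\<dots> = 2 * (\<Sum>n=1..N. \<Sum>d | d dvd n. F d (n div d))"
    by (simp add: sum_distrib_left)
  also have "\<dots> \<le> 2 * (\<Sum>d=1..N. \<Sum>m=1..N. F d m)"
    by (intro mult_left_mono sum_divisors_le) (auto simp: F_def \<tau>_nonneg)
  also have "(\<Sum>d=1..N. \<Sum>m=1..N. F d m) =
      (\<Sum>d=1..N. \<tau> d / real d ^ 2) * (\<Sum>m=1..N. \<tau> m / real m ^ 1)"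
    by (simp only: F_def sum_product)
  also have "\<dots> \<le> 2\<^sup>2 * (1 + ln (real N))\<^sup>2"
  proof (intro mult_mono)
    \<comment> \<open>The tail bound after the first term gives pi^2 / 6 \<le> 1 + 1.\<close>
    have "(\<Sum>d=1..N. 1 / real d ^ 2) \<le> 2"
      using sum_inverse_square_approx(1)[OF assms] sum_inverse_square_approx(2)[of 1] by simp
    then show "(\<Sum>d=1..N. \<tau> d / real d ^ 2) \<le> 2\<^sup>2"
      unfolding \<tau>_def
      by (intro order.trans[OF sum_card_divisors_div_power_le] power_mono) (auto intro!: sum_nonneg)
    show "(\<Sum>m=1..N. \<tau> m / real m ^ 1) \<le> (1 + ln (real N))\<^sup>2"
      unfolding \<tau>_def
      by (intro order.trans[OF sum_card_divisors_div_power_le] power_mono)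
         (use sum_inverse_le_ln[OF assms] in \<open>auto intro!: sum_nonneg\<close>)
  qed (auto intro!: sum_nonneg simp: \<tau>_nonneg)
  finally show ?thesis by simp
qed

section \<open>The asymptotic formula\<close>

text \<open>The first error term comes from the coprime counts; the 1 comes from N times the tail of
  the series of 1 / e^2, which is at most 1 / N.\<close>

lemma sum_varrho_div_totient_approx:
  assumes "N \<ge> 1"
  shows "\<bar>(\<Sum>n=1..N. real (varrho n) / real (totient n)) - pi\<^sup>2 / 6 * real N\<bar>
    \<le> 8 * (1 + ln (real N))\<^sup>2 + 1"
proof -
  define c where "c e = real (card {d\<in>{1..N div e}. coprime d e})" for e
  define Q where "Q = (\<Sum>e=1..N. 1 / (real e)\<^sup>2)"
  have "(\<Sum>n=1..N. real (varrho n) / real (totient n)) =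
      (\<Sum>n=1..N. \<Sum>d | d dvd n. if coprime d (n div d) then 1 / real (totient d) else 0)"
    by (intro sum.cong refl varrho_div_totient) auto
  also have "\<dots> = (\<Sum>e=1..N. \<Sum>m=1..N div e. if coprime e m then 1 / real (totient e) else 0)"
    by (rule sum_divisors_swap)
  also have "\<dots> = (\<Sum>e=1..N. c e / real (totient e))"
  proof (intro sum.cong refl)
    fix e
    have "(\<Sum>m=1..N div e. if coprime e m then 1 / real (totient e) else 0) =
        (\<Sum>m\<in>{m\<in>{1..N div e}. coprime e m}. 1 / real (totient e))"
      by (rule sum.inter_filter[symmetric]) simp
    then show "(\<Sum>m=1..N div e. if coprime e m then 1 / real (totient e) else 0) = c e / real (totient e)"
      by (simp add: c_def coprime_commute)
  qed
  finally have eq: "(\<Sum>n=1..N. real (varrho n) / real (totient n)) = (\<Sum>e=1..N. c e / real (totient e))" .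
  have "\<bar>(\<Sum>e=1..N. c e / real (totient e)) - real N * Q\<bar> =
      \<bar>\<Sum>e=1..N. c e / real (totient e) - real N / (real e)\<^sup>2\<bar>"
    by (simp add: Q_def sum_subtractf sum_distrib_left)
  also have "\<dots> \<le> (\<Sum>e=1..N. 2 ^ card (prime_factors e) / real (totient e))"
  proof (intro order.trans[OF sum_abs] sum_mono)
    fix e assume "e \<in> {1..N}"
    then have e: "e > 0" by simp
    then have tot: "real (totient e) > 0" by simp
    \<comment> \<open>Division by \<open>totient e\<close> cancels the totient in the expected count
      and leaves N / e^2.\<close>
    have "c e / real (totient e) - real N / (real e)\<^sup>2 =
        (c e - real N * real (totient e) / (real e)\<^sup>2) / real (totient e)"
      using tot by (simp add: diff_divide_distrib)
    also have "\<bar>\<dots>\<bar> \<le> 2 ^ card (prime_factors e) / real (totient e)"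
      using card_coprime_approx[OF e, of N] tot by (simp add: c_def divide_right_mono)
    finally show "\<bar>c e / real (totient e) - real N / (real e)\<^sup>2\<bar> \<le> 2 ^ card (prime_factors e) / real (totient e)" .
  qed
  also have "\<dots> \<le> 8 * (1 + ln (real N))\<^sup>2"
    by (rule sum_two_power_div_totient_le[OF assms])
  finally have 1: "\<bar>(\<Sum>e=1..N. c e / real (totient e)) - real N * Q\<bar> \<le> 8 * (1 + ln (real N))\<^sup>2" .
  have "Q \<le> pi\<^sup>2 / 6" "pi\<^sup>2 / 6 \<le> Q + 1 / real N"
    unfolding Q_def using sum_inverse_square_approx[OF assms] by auto
  then have "real N * Q \<le> real N * (pi\<^sup>2 / 6)" "real N * (pi\<^sup>2 / 6) \<le> real N * (Q + 1 / real N)"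
    by (intro mult_left_mono; simp)+
  then have 2: "\<bar>real N * Q - pi\<^sup>2 / 6 * real N\<bar> \<le> 1"
    using assms by (simp add: algebra_simps)
  show ?thesis
    unfolding eq using 1 2 by linarith
qed

theorem theorem4:
  shows "\<exists>C::real. \<forall>x::real. x \<ge> 2 \<longrightarrow>
    \<bar>(\<Sum>n | 1 \<le> n \<and> real n \<le> x. real (varrho n) / real (totient n)) - (pi\<^sup>2 / 6) * x\<bar>
      \<le> C * (ln x)\<^sup>2"
proof (intro exI allI impI)
  fix x :: real assume x: "x \<ge> 2"
  define N where "N = nat \<lfloor>x\<rfloor>"
  have N: "N \<ge> 1" "real N \<le> x" "x \<le> real N + 1"
    using x unfolding N_def by linarith+
  have set: "{n. 1 \<le> n \<and> real n \<le> x} = {1..N}"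
    using N(2) by (auto simp: N_def le_nat_floor)
  have "1 / 2 \<le> ln (2::real)"
    using ln2_ge_two_thirds by linarith
  also have "\<dots> \<le> ln x"
    using x by simp
  \<comment> \<open>This lets every constant be absorbed into a multiple of the squared
    logarithm.\<close>
  finally have ln: "1 \<le> 2 * ln x" by simp
  have "ln (real N) \<le> ln x"
    using N by simp
  then have "(1 + ln (real N))\<^sup>2 \<le> (3 * ln x)\<^sup>2"
    using N ln by (intro power_mono) (linarith | simp)+
  moreover have "1\<^sup>2 \<le> (2 * ln x)\<^sup>2"
    using ln by (intro power_mono) auto
  moreover have "\<bar>pi\<^sup>2 / 6 * real N - pi\<^sup>2 / 6 * x\<bar> \<le> 2"
  proof -
    have "pi\<^sup>2 / 6 \<le> 2"
      using sum_inverse_square_approx(2)[of 1] by simp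
    then have "pi\<^sup>2 / 6 * (x - real N) \<le> 2 * 1"
      using N by (intro mult_mono) auto
    moreover have "pi\<^sup>2 / 6 * real N \<le> pi\<^sup>2 / 6 * x"
      using N by (intro mult_left_mono) auto
    ultimately show ?thesis
      by (simp add: algebra_simps)
  qed
  \<comment> \<open>The constant is 84 = 8 * 9 + 3 * 4: the logarithmic error contributes 8 * 9, and
    the constant errors 1 + 2 are each unit bounded by 4 times the squared logarithm.\<close>
  ultimately show "\<bar>(\<Sum>n | 1 \<le> n \<and> real n \<le> x. real (varrho n) / real (totient n)) - (pi\<^sup>2 / 6) * x\<bar>
      \<le> 84 * (ln x)\<^sup>2"
    unfolding set power_mult_distrib using sum_varrho_div_totient_approx[OF N(1)] by simp
qed

end
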